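(* $\left(\mathscr{H}^2_0\odot\mathscr{H}^2_0\right)^\ast \not\subseteq \mathscr{H}^2$. That is, there are bounded multiplicative Hankel forms $H_\varphi$ on $\mathscr{H}^2_0 \times \mathscr{H}^2_0$ with the property that there is no $\psi \in L^2(\mathbb{T}^\infty)$ such that $H_\varphi = H_\psi$ on $\mathscr{H}^2_0\times\mathscr{H}^2_0$.
   Context: $\mathscr{H}^2$ is the Hilbert space of Dirichlet series $f(s)=\sum_{n\ge1}a_nn^{-s}$ with $\|f\|_{\mathscr{H}^2}=(\sum_{n\ge1}|a_n|^2)^{1/2}<\infty$ and inner product $\langle\cdot,\cdot\rangle$; $\mathscr{H}^2_0$ is its subspace of series with $a_1=f(+\infty)=0$. Weak product: $\mathscr{H}^2_0\odot\mathscr{H}^2_0$ is the Banach space completion of the finite sums $F=\sum_kf_kg_k$, $f_k,g_k\in\mathscr{H}^2_0$, under the norm $\inf\sum_k\|f_k\|_{\mathscr{H}^2}\|g_k\|_{\mathscr{H}^2}$, the infimum being over all finite representations of $F$. Duals: for a Banach space $\mathscr{K}$ of Dirichlet series in which Dirichlet polynomials are dense and a Banach space $\mathscr{X}$ of Dirichlet series, $\mathscr{K}^*\subseteq\mathscr{X}$ means that for every $\upsilon\in\mathscr{K}^*$ there is $\varphi\in\mathscr{X}$ with $\upsilon(f)=\langle f,\varphi\rangle$ for all Dirichlet polynomials $f\in\mathscr{K}$ and $\|\varphi\|_{\mathscr{X}}\le K\|\upsilon\|_{\mathscr{K}^*}$ for a constant $K$ independent of $\upsilon$. Hankel forms: for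 a (formal) Dirichlet series $\varphi(s)=\sum_n\overline{\varrho_n}n^{-s}$, $H_\varphi(fg)=\langle fg,\varphi\rangle=\sum_m\sum_na_mb_n\varrho_{mn}$ for Dirichlet polynomials $f=\sum a_mm^{-s}$, $g=\sum b_nn^{-s}$; it is bounded on $\mathscr{H}^2_0\times\mathscr{H}^2_0$ if $|H_\varphi(fg)|\le K\|f\|_{\mathscr{H}^2}\|g\|_{\mathscr{H}^2}$ for all Dirichlet polynomials $f,g\in\mathscr{H}^2_0$, for some constant $K$. Bohr lift: if $n=\prod_jp_j^{\kappa_j}$ ($p_j$ the $j$th prime), put $\kappa(n)=(\kappa_1,\kappa_2,\dots)$, and $\mathscr{B}f(z)=\sum_na_nz^{\kappa(n)}$, $z=(z_1,z_2,\dots)\in\mathbb{T}^\infty$. With $m_\infty$ the normalized Haar measure on $\mathbb{T}^\infty$ and $\psi\in L^2(\mathbb{T}^\infty)=L^2(\mathbb{T}^\infty,m_\infty)$, put $H_\psi(fg)=\int_{\mathbb{T}^\infty}\mathscr{B}f\,\mathscr{B}g\,\overline{\psi}\,dm_\infty$. The equality $H_\varphi=H_\psi$ means that the two forms agree for all Dirichlet polynomials $f,g\in\mathscr{H}^2_0$. *)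

theory Defs
  imports "HOL-Probability.Probability" "HOL-Computational_Algebra.Primes"
    "HOL-Library.Infinite_Set"
begin

section \<open>Dirichlet series\<close>

text \<open>A (formal) Dirichlet series with coefficients \<open>a\<^sub>n\<close>, \<open>n \<ge> 1\<close>, is its coefficient
  sequence; the meaningless coefficient at index 0 is required to vanish.\<close>

type_synonym dseries = "nat \<Rightarrow> complex"

definition dirichlet_series :: "dseries set" where
  "dirichlet_series = {a. a 0 = 0}"

definition dirichlet_poly :: "dseries set" where
  "dirichlet_poly = {a \<in> dirichlet_series. finite {n. a n \<noteq> 0}}"

definition dirichlet_prod :: "dseries \<Rightarrow> dseries \<Rightarrow> dseries" where
  "dirichlet_prod a b = (\<lambda>n. if n = 0 then 0 else \<Sum>d | d dvd n. a d * b (n div d))"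

definition H2 :: "dseries set" where
  "H2 = {a \<in> dirichlet_series. summable (\<lambda>n. (cmod (a n))\<^sup>2)}"

definition H2_norm :: "dseries \<Rightarrow> real" where
  "H2_norm a = sqrt (\<Sum>n. (cmod (a n))\<^sup>2)"

text \<open>Besides being the inner product of \<open>H2\<close>, this is also used for a Dirichlet polynomial \<open>a\<close>
  and an arbitrary formal Dirichlet series \<open>b\<close>; the sum is then finite.\<close>

definition H2_inner :: "dseries \<Rightarrow> dseries \<Rightarrow> complex" where
  "H2_inner a b = (\<Sum>n. a n * cnj (b n))"

definition H2_0 :: "dseries set" where
  "H2_0 = {a \<in> H2. a 1 = 0}"


section \<open>Completions and their duals\<close>

text \<open>The completion of a normed space of Dirichlet series with carrier \<open>V\<close> and norm \<open>N\<close>: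
  Cauchy sequences modulo null sequences.\<close>

definition cauchy_seqs :: "dseries set \<Rightarrow> (dseries \<Rightarrow> real) \<Rightarrow> (nat \<Rightarrow> dseries) set" where
  "cauchy_seqs V N = {X. range X \<subseteq> V \<and>
     (\<forall>e>0. \<exists>M. \<forall>m\<ge>M. \<forall>n\<ge>M. N (\<lambda>k. X m k - X n k) < e)}"

definition cauchy_class ::
    "dseries set \<Rightarrow> (dseries \<Rightarrow> real) \<Rightarrow> (nat \<Rightarrow> dseries) \<Rightarrow> (nat \<Rightarrow> dseries) set" where
  "cauchy_class V N X =
     {Y \<in> cauchy_seqs V N. (\<lambda>n. N (\<lambda>k. X n k - Y n k)) \<longlonglongrightarrow> 0}"

definition completion :: "dseries set \<Rightarrow> (dseries \<Rightarrow> real) \<Rightarrow> (nat \<Rightarrow> dseries) set set" where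
  "completion V N = cauchy_class V N ` cauchy_seqs V N"

definition completion_norm :: "(dseries \<Rightarrow> real) \<Rightarrow> (nat \<Rightarrow> dseries) set \<Rightarrow> real" where
  "completion_norm N x = (THE r. \<exists>X\<in>x. (\<lambda>n. N (X n)) \<longlonglongrightarrow> r)"

definition completion_embed ::
    "dseries set \<Rightarrow> (dseries \<Rightarrow> real) \<Rightarrow> dseries \<Rightarrow> (nat \<Rightarrow> dseries) set" where
  "completion_embed V N F = cauchy_class V N (\<lambda>_. F)"

definition completion_dual ::
    "dseries set \<Rightarrow> (dseries \<Rightarrow> real) \<Rightarrow> ((nat \<Rightarrow> dseries) set \<Rightarrow> complex) set" where
  "completion_dual V N = {\<upsilon>.
     (\<forall>X\<in>cauchy_seqs V N. \<forall>Y\<in>cauchy_seqs V N.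
        \<upsilon> (cauchy_class V N (\<lambda>n k. X n k + Y n k)) =
        \<upsilon> (cauchy_class V N X) + \<upsilon> (cauchy_class V N Y)) \<and>
     (\<forall>c. \<forall>X\<in>cauchy_seqs V N.
        \<upsilon> (cauchy_class V N (\<lambda>n k. c * X n k)) = c * \<upsilon> (cauchy_class V N X)) \<and>
     (\<exists>C. \<forall>x\<in>completion V N. cmod (\<upsilon> x) \<le> C * completion_norm N x)}"

definition completion_dual_norm ::
    "dseries set \<Rightarrow> (dseries \<Rightarrow> real) \<Rightarrow> ((nat \<Rightarrow> dseries) set \<Rightarrow> complex) \<Rightarrow> real" where
  "completion_dual_norm V N \<upsilon> =
     (SUP x\<in>{x \<in> completion V N. completion_norm N x \<le> 1}. cmod (\<upsilon> x))"

text \<open>The inclusion of the dual of the completion of \<open>(V, N)\<close> in the space \<open>(X, NX)\<close> of Dirichlet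
  series, with respect to the \<open>H2\<close> pairing on Dirichlet polynomials.\<close>

definition dual_included ::
    "dseries set \<Rightarrow> (dseries \<Rightarrow> real) \<Rightarrow> dseries set \<Rightarrow> (dseries \<Rightarrow> real) \<Rightarrow> bool" where
  "dual_included V N X NX \<longleftrightarrow>
     (\<exists>K. \<forall>\<upsilon>\<in>completion_dual V N. \<exists>\<phi>\<in>X.
        (\<forall>f\<in>dirichlet_poly \<inter> V. \<upsilon> (completion_embed V N f) = H2_inner f \<phi>) \<and>
        NX \<phi> \<le> K * completion_dual_norm V N \<upsilon>)"


section \<open>The weak product of \<open>H2_0\<close> with itself\<close>

definition weak_reps :: "dseries \<Rightarrow> (dseries \<times> dseries) list set" where
  "weak_reps F = {xs. set xs \<subseteq> H2_0 \<times> H2_0 \<and>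
     F = (\<lambda>n. \<Sum>(f, g)\<leftarrow>xs. dirichlet_prod f g n)}"

text \<open>The finite sums and their norm; the weak product is \<open>completion weak_fin weak_norm\<close>.\<close>

definition weak_fin :: "dseries set" where
  "weak_fin = {F. weak_reps F \<noteq> {}}"

definition weak_norm :: "dseries \<Rightarrow> real" where
  "weak_norm F = (INF xs\<in>weak_reps F. \<Sum>(f, g)\<leftarrow>xs. H2_norm f * H2_norm g)"


section \<open>Hankel forms\<close>

text \<open>For Dirichlet polynomials \<open>f\<close> and \<open>g\<close> this is the double sum of
  \<open>f m * g n * cnj (\<phi> (m * n))\<close> over \<open>m\<close> and \<open>n\<close>.\<close>

definition hankel :: "dseries \<Rightarrow> dseries \<Rightarrow> dseries \<Rightarrow> complex" where
  "hankel \<phi> f g = H2_inner (dirichlet_prod f g) \<phi>"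

definition hankel_bounded :: "dseries \<Rightarrow> bool" where
  "hankel_bounded \<phi> \<longleftrightarrow>
     (\<exists>K. \<forall>f\<in>dirichlet_poly \<inter> H2_0. \<forall>g\<in>dirichlet_poly \<inter> H2_0.
        cmod (hankel \<phi> f g) \<le> K * H2_norm f * H2_norm g)"


section \<open>The infinite torus and the Bohr lift\<close>

definition circle_measure :: "complex measure" where
  "circle_measure =
     distr (uniform_measure lborel {0..1::real}) (restrict_space borel (sphere 0 1))
       (\<lambda>t. cis (2 * pi * t))"

text \<open>The normalized Haar measure on the infinite torus is the product of the normalized
  arc length measures.\<close>

definition torus_measure :: "(nat \<Rightarrow> complex) measure" where
  "torus_measure = (\<Pi>\<^sub>M j\<in>UNIV. circle_measure)"

definition L2_torus :: "((nat \<Rightarrow> complex) \<Rightarrow> complex) set" where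
  "L2_torus = {\<psi> \<in> borel_measurable torus_measure.
     integrable torus_measure (\<lambda>z. (cmod (\<psi> z))\<^sup>2)}"

definition nth_prime :: "nat \<Rightarrow> nat" where
  "nth_prime j = enumerate {p. prime p} j"

definition bohr_monomial :: "nat \<Rightarrow> (nat \<Rightarrow> complex) \<Rightarrow> complex" where
  "bohr_monomial n z =
     (\<Prod>j | nth_prime j dvd n. z j ^ multiplicity (nth_prime j) n)"

text \<open>Only used for Dirichlet polynomials.\<close>

definition bohr_lift :: "dseries \<Rightarrow> (nat \<Rightarrow> complex) \<Rightarrow> complex" where
  "bohr_lift f z = (\<Sum>n | f n \<noteq> 0. f n * bohr_monomial n z)"

definition hankel_torus ::
    "((nat \<Rightarrow> complex) \<Rightarrow> complex) \<Rightarrow> dseries \<Rightarrow> dseries \<Rightarrow> complex" where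
  "hankel_torus \<psi> f g =
     (LINT z|torus_measure. bohr_lift f z * bohr_lift g z * cnj (\<psi> z))"

lemma prob_space_circle_measure: "prob_space circle_measure"
proof -
  interpret prob_space "uniform_measure lborel {0..1::real}"
    by (rule prob_space_uniform_measure) auto
  have "(\<lambda>t::real. cis (2 * pi * t)) \<in> borel_measurable borel"
    by (intro borel_measurable_continuous_onI continuous_intros)
  then show ?thesis
    unfolding circle_measure_def
    by (intro prob_space_distr measurable_restrict_space2) auto
qed

lemma prob_space_torus_measure: "prob_space torus_measure"
  unfolding torus_measure_def by (intro prob_space_PiM prob_space_circle_measure)

lemma space_torus_measure: "space torus_measure = {z. \<forall>j. cmod (z j) = 1}"
  by (auto simp: torus_measure_def circle_measure_def space_PiM space_restrict_space PiE_iff)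

end

theory Submission
  imports Defs
begin

text \<open>Let \<open>f, g\<close> in \<open>\<H>\<^sup>2\<^sub>0\<close> have coefficients \<open>a\<^sub>n, b\<^sub>n\<close>. Since \<open>a\<^sub>1 = b\<^sub>1 = 0\<close>, the coefficient of
  \<open>fg\<close> at \<open>p\<^sup>2\<close>, \<open>p\<close> prime, is \<open>a\<^sub>p b\<^sub>p\<close>. Hence the symbol \<open>\<phi>\<close> with coefficient \<open>1\<close> at each square of
  a prime, and \<open>0\<close> elsewhere, has the Hankel form \<open>H\<^sub>\<phi>(fg) = \<Sum>\<^sub>p a\<^sub>p b\<^sub>p\<close>, which is bounded by the
  Cauchy--Schwarz inequality and so extends to the weak product. A representing series would have
  coefficient \<open>1\<close> at every \<open>p\<^sup>2\<close>, which is impossible in \<open>\<H>\<^sup>2\<close>; likewise a function \<open>\<psi>\<close> on the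
  torus with \<open>H\<^sub>\<psi> = H\<^sub>\<phi>\<close> would have coefficient \<open>1\<close> with respect to each of the orthonormal
  functions \<open>z\<^sub>j\<^sup>2\<close>, contradicting Bessel's inequality.\<close>

section \<open>Functionals on a completion\<close>

text \<open>A seminorm is enough, since the completion identifies sequences whose distance tends to
  0. Homogeneity appears as an inequality; using it with the factor \<open>-1\<close> in both
  directions gives the symmetry in \<open>diff_commute\<close>.\<close>

locale seminormed_dseries =
  fixes V :: "dseries set" and N :: "dseries \<Rightarrow> real"
  assumes add_mem: "F \<in> V \<Longrightarrow> G \<in> V \<Longrightarrow> (\<lambda>k. F k + G k) \<in> V"
    and scale_mem: "F \<in> V \<Longrightarrow> (\<lambda>k. c * F k) \<in> V"
    and triangle: "F \<in> V \<Longrightarrow> G \<in> V \<Longrightarrow> N (\<lambda>k. F k + G k) \<le> N F + N G"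
    and scale_le: "F \<in> V \<Longrightarrow> N (\<lambda>k. c * F k) \<le> cmod c * N F"
begin

lemma diff_mem:
  assumes "F \<in> V" "G \<in> V" shows "(\<lambda>k. F k - G k) \<in> V"
  using add_mem[OF assms(1) scale_mem[OF assms(2), of "-1"]] by simp

lemma diff_commute:
  assumes "F \<in> V" "G \<in> V" shows "N (\<lambda>k. F k - G k) = N (\<lambda>k. G k - F k)"
  using scale_le[OF diff_mem[OF assms], of "-1"] scale_le[OF diff_mem[OF assms(2,1)], of "-1"]
  by simp

text \<open>The sum \<open>F + (-F)\<close> gives \<open>N 0 \<le> 2 * N F\<close>, while
  \<open>F + 0\<close> gives \<open>N F \<le> N F + N 0\<close>, so that
  \<open>N 0 \<ge> 0\<close>.\<close>

lemma nonneg: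
  assumes "F \<in> V" shows "0 \<le> N F"
  using triangle[OF assms scale_mem[OF assms, of "-1"]] scale_le[OF assms, of "-1"]
    triangle[OF assms scale_mem[OF assms, of 0]] by simp

lemma seminorm_zero:
  assumes "F \<in> V" shows "N (\<lambda>_. 0) = 0"
  using scale_le[OF assms, of 0] nonneg[OF scale_mem[OF assms, of 0]] by simp

text \<open>The reverse triangle inequality in Lipschitz form, so that
  \<open>cauchy_class_limit\<close> can be applied to \<open>N\<close> itself.\<close>

lemma dist_le:
  assumes "F \<in> V" "G \<in> V" shows "dist (N F) (N G) \<le> N (\<lambda>k. F k - G k)"
proof -
  have "N F \<le> N G + N (\<lambda>k. F k - G k)"
    using triangle[OF assms(2) diff_mem[OF assms]] by simp
  moreover have "N G \<le> N F + N (\<lambda>k. F k - G k)"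
    using triangle[OF assms(1) diff_mem[OF assms(2,1)]] unfolding diff_commute[OF assms] by simp
  ultimately show ?thesis
    by (simp add: dist_real_def abs_le_iff)
qed

section \<open>Cauchy sequences and the vector operations\<close>

lemma cauchy_seqs_mem: "X \<in> cauchy_seqs V N \<Longrightarrow> X n \<in> V"
  by (auto simp: cauchy_seqs_def)

lemma cauchy_seqsE:
  assumes "X \<in> cauchy_seqs V N" "0 < e"
  obtains M where "\<And>m n. m \<ge> M \<Longrightarrow> n \<ge> M \<Longrightarrow> N (\<lambda>k. X m k - X n k) < e"
proof -
  have "\<exists>M. \<forall>m\<ge>M. \<forall>n\<ge>M. N (\<lambda>k. X m k - X n k) < e"
    using assms by (simp add: cauchy_seqs_def)
  then show thesis
    using that by auto
qed

lemma cauchy_seqs_const: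
  assumes "F \<in> V" shows "(\<lambda>_. F) \<in> cauchy_seqs V N"
  using assms seminorm_zero[OF assms] by (auto simp: cauchy_seqs_def)

lemma cauchy_seqs_add:
  assumes X: "X \<in> cauchy_seqs V N" and Y: "Y \<in> cauchy_seqs V N"
  shows "(\<lambda>n k. X n k + Y n k) \<in> cauchy_seqs V N"
  unfolding cauchy_seqs_def mem_Collect_eq
proof (intro conjI allI impI)
  show "range (\<lambda>n k. X n k + Y n k) \<subseteq> V"
    using X Y by (auto simp: cauchy_seqs_mem intro!: add_mem)
  fix e :: real assume "e > 0"
  then have "0 < e / 2" by simp
  obtain M1 where M1: "\<And>m n. m \<ge> M1 \<Longrightarrow> n \<ge> M1 \<Longrightarrow> N (\<lambda>k. X m k - X n k) < e / 2"
    using cauchy_seqsE[OF X \<open>0 < e / 2\<close>] by blast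
  obtain M2 where M2: "\<And>m n. m \<ge> M2 \<Longrightarrow> n \<ge> M2 \<Longrightarrow> N (\<lambda>k. Y m k - Y n k) < e / 2"
    using cauchy_seqsE[OF Y \<open>0 < e / 2\<close>] by blast
  have "N (\<lambda>k. X m k + Y m k - (X n k + Y n k)) < e" if "m \<ge> max M1 M2" "n \<ge> max M1 M2" for m n
    using triangle[OF diff_mem[OF cauchy_seqs_mem cauchy_seqs_mem, OF X X, of m n]
        diff_mem[OF cauchy_seqs_mem cauchy_seqs_mem, OF Y Y, of m n]] M1[of m n] M2[of m n] that
    by (simp add: add_diff_add)
  then show "\<exists>M. \<forall>m\<ge>M. \<forall>n\<ge>M. N (\<lambda>k. X m k + Y m k - (X n k + Y n k)) < e"
    by blast
qed

lemma cauchy_seqs_scale: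
  assumes X: "X \<in> cauchy_seqs V N"
  shows "(\<lambda>n k. c * X n k) \<in> cauchy_seqs V N"
  unfolding cauchy_seqs_def mem_Collect_eq
proof (intro conjI allI impI)
  show "range (\<lambda>n k. c * X n k) \<subseteq> V"
    using X by (auto simp: cauchy_seqs_mem intro!: scale_mem)
  fix e :: real assume "e > 0"
  \<comment> \<open>The summand 1 keeps the divisor positive when \<open>c = 0\<close>.\<close>
  then have "e / (cmod c + 1) > 0"
    by (simp add: add_nonneg_pos)
  then obtain M where
    M: "\<And>m n. m \<ge> M \<Longrightarrow> n \<ge> M \<Longrightarrow> N (\<lambda>k. X m k - X n k) < e / (cmod c + 1)"
    using cauchy_seqsE[OF X] by blast
  have "N (\<lambda>k. c * X m k - c * X n k) < e" if "m \<ge> M" "n \<ge> M" for m n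
  proof -
    have mem: "(\<lambda>k. X m k - X n k) \<in> V"
      using X by (simp add: cauchy_seqs_mem diff_mem)
    have "N (\<lambda>k. c * X m k - c * X n k) \<le> cmod c * N (\<lambda>k. X m k - X n k)"
      using scale_le[OF mem, of c] by (simp add: right_diff_distrib)
    also have "\<dots> \<le> (cmod c + 1) * N (\<lambda>k. X m k - X n k)"
      using nonneg[OF mem] by (simp add: mult_right_mono)
    also have "\<dots> < e"
      using M[OF that] by (simp add: pos_less_divide_eq add_nonneg_pos mult.commute)
    finally show ?thesis .
  qed
  then show "\<exists>M. \<forall>m\<ge>M. \<forall>n\<ge>M. N (\<lambda>k. c * X m k - c * X n k) < e"
    by blast
qed

lemma cauchy_class_self: "X \<in> cauchy_seqs V N \<Longrightarrow> X \<in> cauchy_class V N X"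
  using seminorm_zero[OF cauchy_seqs_mem] by (simp add: cauchy_class_def)

text \<open>A Lipschitz map into a complete space sends Cauchy sequences to convergent ones, and
  sequences at distance tending to 0 share their limit. Hence the definite description is well
  defined on a class. It is used for \<open>N\<close>, giving \<open>completion_norm\<close>, and
  for functionals, giving their extension.\<close>

lemma cauchy_class_limit:
  fixes f :: "dseries \<Rightarrow> 'b::complete_space"
  assumes lip: "\<And>F G. F \<in> V \<Longrightarrow> G \<in> V \<Longrightarrow> dist (f F) (f G) \<le> N (\<lambda>k. F k - G k)"
    and X: "X \<in> cauchy_seqs V N"
  shows "(\<lambda>n. f (X n)) \<longlonglongrightarrow> (THE r. \<exists>Y\<in>cauchy_class V N X. (\<lambda>n. f (Y n)) \<longlonglongrightarrow> r)"
proof -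
  have "Cauchy (\<lambda>n. f (X n))"
    unfolding Cauchy_def
  proof (intro allI impI)
    fix e :: real assume "e > 0"
    then obtain M where "\<And>m n. m \<ge> M \<Longrightarrow> n \<ge> M \<Longrightarrow> N (\<lambda>k. X m k - X n k) < e"
      using cauchy_seqsE[OF X] by blast
    then show "\<exists>M. \<forall>m\<ge>M. \<forall>n\<ge>M. dist (f (X m)) (f (X n)) < e"
      using lip[OF cauchy_seqs_mem cauchy_seqs_mem, OF X X] by (meson order_le_less_trans)
  qed
  then obtain r where r: "(\<lambda>n. f (X n)) \<longlonglongrightarrow> r"
    using Cauchy_convergent convergent_def by blast
  have unique: "s = r" if Y: "Y \<in> cauchy_class V N X" and s: "(\<lambda>n. f (Y n)) \<longlonglongrightarrow> s" for Y s
  proof -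
    have "(\<lambda>n. dist (f (X n)) (f (Y n))) \<longlonglongrightarrow> 0"
    proof (rule tendsto_sandwich[OF _ _ tendsto_const])
      show "(\<lambda>n. N (\<lambda>k. X n k - Y n k)) \<longlonglongrightarrow> 0"
        using Y by (simp add: cauchy_class_def)
      have "Y \<in> cauchy_seqs V N"
        using Y by (simp add: cauchy_class_def)
      then show "\<forall>\<^sub>F n in sequentially. dist (f (X n)) (f (Y n)) \<le> N (\<lambda>k. X n k - Y n k)"
        using X by (auto intro!: always_eventually lip cauchy_seqs_mem)
    qed auto
    moreover have "(\<lambda>n. dist (f (X n)) (f (Y n))) \<longlonglongrightarrow> dist r s"
      by (intro tendsto_dist r s)
    ultimately show "s = r"
      using LIMSEQ_unique by fastforce
  qed
  have "(THE r. \<exists>Y\<in>cauchy_class V N X. (\<lambda>n. f (Y n)) \<longlonglongrightarrow> r) = r"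
  proof (rule the_equality)
    show "\<exists>Y\<in>cauchy_class V N X. (\<lambda>n. f (Y n)) \<longlonglongrightarrow> r"
      by (rule bexI, rule r, rule cauchy_class_self[OF X])
    show "s = r" if "\<exists>Y\<in>cauchy_class V N X. (\<lambda>n. f (Y n)) \<longlonglongrightarrow> s" for s
      using that by (elim bexE) (rule unique)
  qed
  then show ?thesis
    using r by simp
qed

lemma completion_norm_limit:
  "X \<in> cauchy_seqs V N \<Longrightarrow> (\<lambda>n. N (X n)) \<longlonglongrightarrow> completion_norm N (cauchy_class V N X)"
  unfolding completion_norm_def by (intro cauchy_class_limit dist_le)

text \<open>Extension by continuity: the value on a class is the common limit of \<open>L\<close>
  along its representatives, and linearity and the bound with constant 1 pass to the limit.\<close>

lemma completion_dual_extension: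
  fixes L :: "dseries \<Rightarrow> complex"
  assumes add: "\<And>F G. F \<in> V \<Longrightarrow> G \<in> V \<Longrightarrow> L (\<lambda>k. F k + G k) = L F + L G"
    and scale: "\<And>c F. F \<in> V \<Longrightarrow> L (\<lambda>k. c * F k) = c * L F"
    and bound: "\<And>F. F \<in> V \<Longrightarrow> cmod (L F) \<le> N F"
  shows "\<exists>\<upsilon>\<in>completion_dual V N. \<forall>F\<in>V. \<upsilon> (completion_embed V N F) = L F"
proof -
  define \<upsilon> where "\<upsilon> x = (THE r. \<exists>Y\<in>x. (\<lambda>n. L (Y n)) \<longlonglongrightarrow> r)" for x
  have lip: "dist (L F) (L G) \<le> N (\<lambda>k. F k - G k)" if "F \<in> V" "G \<in> V" for F G
    using add[OF that(1) scale_mem[OF that(2), of "-1"]] scale[OF that(2), of "-1"]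
      bound[OF diff_mem[OF that]] by (simp add: dist_norm)
  have lim: "(\<lambda>n. L (X n)) \<longlonglongrightarrow> \<upsilon> (cauchy_class V N X)" if "X \<in> cauchy_seqs V N" for X
    unfolding \<upsilon>_def by (rule cauchy_class_limit[OF lip that])
  show ?thesis
  proof (intro bexI[of _ \<upsilon>] ballI)
    show "\<upsilon> (completion_embed V N F) = L F" if "F \<in> V" for F
      using lim[OF cauchy_seqs_const[OF that]]
      by (simp add: completion_embed_def LIMSEQ_const_iff)
    have "\<upsilon> (cauchy_class V N (\<lambda>n k. X n k + Y n k)) =
        \<upsilon> (cauchy_class V N X) + \<upsilon> (cauchy_class V N Y)"
      if X: "X \<in> cauchy_seqs V N" and Y: "Y \<in> cauchy_seqs V N" for X Y
      using lim[OF cauchy_seqs_add[OF X Y]] tendsto_add[OF lim[OF X] lim[OF Y]]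
      by (simp add: add cauchy_seqs_mem[OF X] cauchy_seqs_mem[OF Y] LIMSEQ_unique)
    moreover have "\<upsilon> (cauchy_class V N (\<lambda>n k. c * X n k)) = c * \<upsilon> (cauchy_class V N X)"
      if X: "X \<in> cauchy_seqs V N" for c X
      using lim[OF cauchy_seqs_scale[OF X, of c]] tendsto_mult_left[OF lim[OF X], of c]
      by (simp add: scale cauchy_seqs_mem[OF X] LIMSEQ_unique)
    moreover have "cmod (\<upsilon> x) \<le> 1 * completion_norm N x" if x: "x \<in> completion V N" for x
    proof -
      obtain X where X: "X \<in> cauchy_seqs V N" and x: "x = cauchy_class V N X"
        using x by (auto simp: completion_def)
      have "cmod (\<upsilon> x) \<le> completion_norm N x"
        unfolding x using bound[OF cauchy_seqs_mem[OF X]]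
        by (intro LIMSEQ_le[OF tendsto_norm[OF lim[OF X]] completion_norm_limit[OF X]]) auto
      then show ?thesis by simp
    qed
    ultimately show "\<upsilon> \<in> completion_dual V N"
      unfolding completion_dual_def by blast
  qed
qed

end


section \<open>The weak product\<close>

lemma dirichlet_prod_scale: "dirichlet_prod (\<lambda>k. c * f k) g n = c * dirichlet_prod f g n"
  by (simp add: dirichlet_prod_def sum_distrib_left mult.assoc)

lemma H2_norm_nonneg: "f \<in> H2 \<Longrightarrow> 0 \<le> H2_norm f"
  by (simp add: H2_norm_def H2_def suminf_nonneg)

lemma H2_0_scale:
  assumes "f \<in> H2_0" shows "(\<lambda>k. c * f k) \<in> H2_0"
  using assms by (auto simp: H2_0_def H2_def dirichlet_series_def norm_mult power_mult_distrib)

lemma H2_norm_scale: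
  assumes "f \<in> H2" shows "H2_norm (\<lambda>k. c * f k) = cmod c * H2_norm f"
  using assms by (simp add: H2_norm_def H2_def norm_mult power_mult_distrib suminf_mult real_sqrt_mult)

section \<open>Representations, their cost and the weak norm\<close>

definition rep_cost :: "(dseries \<times> dseries) list \<Rightarrow> real" where
  "rep_cost xs = (\<Sum>(f, g)\<leftarrow>xs. H2_norm f * H2_norm g)"

lemma rep_cost_nonneg: "set xs \<subseteq> H2_0 \<times> H2_0 \<Longrightarrow> 0 \<le> rep_cost xs"
  by (auto simp: rep_cost_def H2_0_def intro!: sum_list_nonneg mult_nonneg_nonneg H2_norm_nonneg)

lemma weak_norm_le: "xs \<in> weak_reps F \<Longrightarrow> weak_norm F \<le> rep_cost xs"
  unfolding weak_norm_def rep_cost_def[symmetric]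
  by (intro cINF_lower bdd_belowI2[where m=0] rep_cost_nonneg) (auto simp: weak_reps_def)

text \<open>Membership in \<open>weak_fin\<close> makes the infimum range over a nonempty
  set.\<close>

lemma weak_norm_ge:
  "F \<in> weak_fin \<Longrightarrow> (\<And>xs. xs \<in> weak_reps F \<Longrightarrow> r \<le> rep_cost xs) \<Longrightarrow> r \<le> weak_norm F"
  unfolding weak_norm_def rep_cost_def[symmetric] weak_fin_def by (auto intro: cINF_greatest)

lemma weak_reps_append:
  "xs \<in> weak_reps F \<Longrightarrow> ys \<in> weak_reps G \<Longrightarrow> xs @ ys \<in> weak_reps (\<lambda>k. F k + G k)"
  by (auto simp: weak_reps_def)

lemma weak_reps_scale:
  assumes "xs \<in> weak_reps F"
  shows "map (\<lambda>(f, g). (\<lambda>k. c * f k, g)) xs \<in> weak_reps (\<lambda>k. c * F k)"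
  using assms
  by (auto simp: weak_reps_def o_def split_def dirichlet_prod_scale sum_list_const_mult
      intro!: H2_0_scale)

lemma rep_cost_append: "rep_cost (xs @ ys) = rep_cost xs + rep_cost ys"
  by (simp add: rep_cost_def)

lemma rep_cost_scale:
  assumes "set xs \<subseteq> H2_0 \<times> H2_0"
  shows "rep_cost (map (\<lambda>(f, g). (\<lambda>k. c * f k, g)) xs) = cmod c * rep_cost xs"
  using assms by (induction xs) (auto simp: rep_cost_def H2_norm_scale H2_0_def algebra_simps)

text \<open>Concatenating representations gives the triangle inequality; multiplying all first
  factors by \<open>c\<close> gives homogeneity.\<close>

interpretation weak: seminormed_dseries weak_fin weak_norm
proof
  fix F G :: dseries and c :: complex
  assume F: "F \<in> weak_fin"
  then show "(\<lambda>k. c * F k) \<in> weak_fin"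
    using weak_reps_scale by (fastforce simp: weak_fin_def)
  show "weak_norm (\<lambda>k. c * F k) \<le> cmod c * weak_norm F"
  proof (cases "c = 0")
    case True
    \<comment> \<open>Division by \<open>cmod c\<close> is impossible here, but the empty
      representation of the zero series has cost 0.\<close>
    have "[] \<in> weak_reps (\<lambda>_. 0)"
      by (simp add: weak_reps_def)
    from weak_norm_le[OF this] True show ?thesis
      by (simp add: rep_cost_def)
  next
    case False
    have "weak_norm (\<lambda>k. c * F k) / cmod c \<le> rep_cost xs" if "xs \<in> weak_reps F" for xs
      using weak_norm_le[OF weak_reps_scale[OF that, of c]] rep_cost_scale[of xs c] that False
      by (simp add: weak_reps_def field_simps)
    then have "weak_norm (\<lambda>k. c * F k) / cmod c \<le> weak_norm F"
      by (rule weak_norm_ge[OF F])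
    then show ?thesis
      using False by (simp add: field_simps)
  qed
  assume G: "G \<in> weak_fin"
  show "(\<lambda>k. F k + G k) \<in> weak_fin"
    using F G weak_reps_append by (fastforce simp: weak_fin_def)
  \<comment> \<open>The infima are taken one after the other: over representations of
    \<open>F\<close> with \<open>ys\<close> fixed, then over \<open>ys\<close>.\<close>
  have "weak_norm (\<lambda>k. F k + G k) - rep_cost ys \<le> weak_norm F" if "ys \<in> weak_reps G" for ys
    using weak_norm_le[OF weak_reps_append[OF _ that, of _ F]]
    by (intro weak_norm_ge[OF F]) (simp add: rep_cost_append diff_le_eq)
  then have "weak_norm (\<lambda>k. F k + G k) - weak_norm F \<le> weak_norm G"
    by (intro weak_norm_ge[OF G]) (simp add: diff_le_eq add.commute)
  then show "weak_norm (\<lambda>k. F k + G k) \<le> weak_norm F + weak_norm G"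
    by simp
qed


section \<open>The symbol\<close>

definition prime_square_symbol :: dseries where
  "prime_square_symbol n = of_bool (\<exists>p. prime p \<and> n = p\<^sup>2)"

text \<open>Of the three divisors of \<open>p\<^sup>2\<close>, the divisor 1 brings the factor
  \<open>f 1\<close> and the divisor \<open>p\<^sup>2\<close> the factor \<open>g 1\<close>, both
  zero; only the middle one survives.\<close>

lemma dirichlet_prod_prime_square:
  assumes "prime p" "f 1 = 0" "g 1 = 0"
  shows "dirichlet_prod f g (p\<^sup>2) = f p * g p"
proof -
  have "{d. d dvd p\<^sup>2} = {1, p, p\<^sup>2}"
    using divides_primepow_nat[OF assms(1), of _ 2] by (auto simp: numeral_2_eq_2 le_Suc_eq)
  moreover have "p \<noteq> 1" "p\<^sup>2 \<noteq> p" "p\<^sup>2 \<noteq> 1" "p > 0"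
    using assms(1) prime_gt_1_nat[OF assms(1)] by (auto simp: power2_eq_square)
  ultimately show ?thesis
    using assms(2,3) by (simp add: dirichlet_prod_def power2_eq_square)
qed

text \<open>The finite Cauchy-Schwarz inequality bounds all partial sums uniformly, which yields
  both convergence and the bound on the limit.\<close>

lemma H2_cauchy_schwarz:
  assumes f: "f \<in> H2" and g: "g \<in> H2"
  shows "summable (\<lambda>n. cmod (f n) * cmod (g n))"
    and "(\<Sum>n. cmod (f n) * cmod (g n)) \<le> H2_norm f * H2_norm g"
proof -
  have L2: "L2_set (\<lambda>n. cmod (h n)) {..<n} \<le> H2_norm h" if "h \<in> H2" for h n
    unfolding L2_set_def H2_norm_def using that
    by (intro real_sqrt_le_mono sum_le_suminf) (auto simp: H2_def)
  have *: "(\<Sum>i<n. cmod (f i) * cmod (g i)) \<le> H2_norm f * H2_norm g" for n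
  proof -
    have "(\<Sum>i<n. cmod (f i) * cmod (g i)) \<le> L2_set (\<lambda>n. cmod (f n)) {..<n} * L2_set (\<lambda>n. cmod (g n)) {..<n}"
      using L2_set_mult_ineq[of "\<lambda>n. cmod (f n)" "\<lambda>n. cmod (g n)" "{..<n}"] by simp
    also have "\<dots> \<le> H2_norm f * H2_norm g"
      by (intro mult_mono L2 f g L2_set_nonneg H2_norm_nonneg)
    finally show ?thesis .
  qed
  show summ: "summable (\<lambda>n. cmod (f n) * cmod (g n))"
    \<comment> \<open>The criterion bounds sums over \<open>{..n}\<close>, which are the sums over
      \<open>{..<Suc n}\<close>.\<close>
    by (rule bounded_imp_summable[of _ "H2_norm f * H2_norm g"])
      (use *[of "Suc _"] in \<open>auto simp: lessThan_Suc_atMost\<close>)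
  show "(\<Sum>n. cmod (f n) * cmod (g n)) \<le> H2_norm f * H2_norm g"
    using summ * by (rule suminf_le_const)
qed

text \<open>Factors in \<open>H2_0\<close> may have infinitely many coefficients, so convergence of
  the pairing is proved along with the bound. Reindexing along the squares turns the pairing into
  the sum of \<open>f p * g p\<close> over primes.\<close>

lemma hankel_prime_square_symbol:
  assumes f: "f \<in> H2_0" and g: "g \<in> H2_0"
  shows "summable (\<lambda>n. dirichlet_prod f g n * cnj (prime_square_symbol n))"
    and "cmod (hankel prime_square_symbol f g) \<le> H2_norm f * H2_norm g"
proof -
  let ?h = "\<lambda>n. dirichlet_prod f g n * cnj (prime_square_symbol n)"
  let ?k = "\<lambda>n. of_bool (prime n) * (f n * g n)"
  have mono: "strict_mono (\<lambda>n::nat. n\<^sup>2)"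
    by (auto intro!: strict_monoI power_strict_mono)
  have zero: "?h n = 0" if "n \<notin> range (\<lambda>n. n\<^sup>2)" for n
    using that by (auto simp: prime_square_symbol_def)
  \<comment> \<open>Squaring is injective, so \<open>n\<^sup>2\<close> is the square of a prime only
    if \<open>n\<close> itself is prime.\<close>
  have hk: "(\<lambda>n. ?h (n\<^sup>2)) = ?k"
  proof
    show "?h (n\<^sup>2) = ?k n" for n
      using f g dirichlet_prod_prime_square[of n f g]
      by (auto simp: prime_square_symbol_def H2_0_def)
  qed
  have "f \<in> H2" "g \<in> H2"
    using f g by (auto simp: H2_0_def)
  note cs = H2_cauchy_schwarz[OF this]
  have le: "cmod (?k n) \<le> cmod (f n) * cmod (g n)" for n
    by (simp add: norm_mult)
  have summ: "summable (\<lambda>n. cmod (?k n))"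
    using le by (intro summable_comparison_test'[OF cs(1)]) auto
  then show "summable ?h"
    using summable_mono_reindex[where f = ?h, OF mono zero] unfolding hk
    by (blast intro: summable_norm_cancel)
  have eq: "hankel prime_square_symbol f g = suminf ?k"
    using suminf_mono_reindex[where f = ?h, OF mono zero] unfolding hk hankel_def H2_inner_def ..
  have "cmod (suminf ?k) \<le> (\<Sum>n. cmod (?k n))"
    by (rule summable_norm[OF summ])
  also have "\<dots> \<le> (\<Sum>n. cmod (f n) * cmod (g n))"
    by (rule suminf_le[OF le summ cs(1)])
  finally show "cmod (hankel prime_square_symbol f g) \<le> H2_norm f * H2_norm g"
    using cs(2) eq by simp
qed

text \<open>Convergence is carried through the induction together with the bound, because the
  pairing is additive only for convergent series.\<close>

lemma H2_inner_prime_square_symbol_rep: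
  assumes "set xs \<subseteq> H2_0 \<times> H2_0"
  defines "F \<equiv> \<lambda>n. \<Sum>(f, g)\<leftarrow>xs. dirichlet_prod f g n"
  shows "summable (\<lambda>n. F n * cnj (prime_square_symbol n)) \<and>
    cmod (H2_inner F prime_square_symbol) \<le> rep_cost xs"
  using assms(1) unfolding F_def
proof (induction xs)
  case Nil
  then show ?case by (simp add: H2_inner_def rep_cost_def)
next
  case (Cons x xs)
  obtain f g where x: "x = (f, g)" by (cases x)
  let ?S = prime_square_symbol
  let ?F = "\<lambda>n. \<Sum>(f, g)\<leftarrow>xs. dirichlet_prod f g n"
  have fg: "f \<in> H2_0" "g \<in> H2_0"
    using Cons.prems x by auto
  have IH: "summable (\<lambda>n. ?F n * cnj (?S n))" "cmod (H2_inner ?F ?S) \<le> rep_cost xs"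
    using Cons by auto
  note S = hankel_prime_square_symbol[OF fg]
  have "H2_inner (\<lambda>n. dirichlet_prod f g n + ?F n) ?S = hankel ?S f g + H2_inner ?F ?S"
    using suminf_add[OF S(1) IH(1)] by (simp add: H2_inner_def hankel_def distrib_right)
  then have "cmod (H2_inner (\<lambda>n. dirichlet_prod f g n + ?F n) ?S) \<le> H2_norm f * H2_norm g + rep_cost xs"
    using norm_triangle_mono[OF S(2) IH(2)] by simp
  then show ?case
    using summable_add[OF S(1) IH(1)] by (simp add: x rep_cost_def distrib_right)
qed

lemma summable_prime_square_symbol:
  "F \<in> weak_fin \<Longrightarrow> summable (\<lambda>n. F n * cnj (prime_square_symbol n))"
  using H2_inner_prime_square_symbol_rep by (fastforce simp: weak_fin_def weak_reps_def)

text \<open>The pairing depends only on \<open>F\<close>, so its bound by the cost of every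
  representation passes to the infimum.\<close>

lemma H2_inner_prime_square_symbol_le:
  "F \<in> weak_fin \<Longrightarrow> cmod (H2_inner F prime_square_symbol) \<le> weak_norm F"
  using H2_inner_prime_square_symbol_rep by (intro weak_norm_ge) (auto simp: weak_reps_def)

section \<open>Monomials as test elements\<close>

definition dirichlet_monomial :: "nat \<Rightarrow> dseries" where
  "dirichlet_monomial m = (\<lambda>n. of_bool (n = m))"

lemma H2_inner_monomial: "H2_inner (dirichlet_monomial m) \<phi> = cnj (\<phi> m)"
proof -
  have "(\<lambda>n. dirichlet_monomial m n * cnj (\<phi> n)) = (\<lambda>n. if n = m then cnj (\<phi> n) else 0)"
    by (auto simp: dirichlet_monomial_def)
  then show ?thesis
    using sums_unique[OF sums_single[of m "\<lambda>n. cnj (\<phi> n)"]] by (simp add: H2_inner_def)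
qed

text \<open>At \<open>n > 0\<close> only the divisor \<open>d = a\<close> can contribute, and it
  does so exactly when \<open>n = a * b\<close>. At index 0 both sides vanish because
  \<open>a * b > 0\<close>.\<close>

lemma dirichlet_prod_monomial:
  assumes "a > 0" "b > 0"
  shows "dirichlet_prod (dirichlet_monomial a) (dirichlet_monomial b) = dirichlet_monomial (a * b)"
proof
  fix n
  show "dirichlet_prod (dirichlet_monomial a) (dirichlet_monomial b) n = dirichlet_monomial (a * b) n"
  proof (cases "n = 0")
    case False
    then have "dirichlet_prod (dirichlet_monomial a) (dirichlet_monomial b) n =
        (\<Sum>d | d dvd n. if d = a then of_bool (n div d = b) else 0)"
      by (auto simp: dirichlet_prod_def dirichlet_monomial_def intro!: sum.cong)
    also have "\<dots> = dirichlet_monomial (a * b) n"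
      using False assms by (auto simp: dirichlet_monomial_def)
    finally show ?thesis .
  qed (use assms in \<open>auto simp: dirichlet_prod_def dirichlet_monomial_def\<close>)
qed

lemma dirichlet_monomial_poly: "m > 0 \<Longrightarrow> dirichlet_monomial m \<in> dirichlet_poly"
  by (simp add: dirichlet_poly_def dirichlet_series_def dirichlet_monomial_def)

lemma dirichlet_monomial_H2_0:
  assumes "m > 1" shows "dirichlet_monomial m \<in> H2_0"
proof -
  have "summable (\<lambda>n. (cmod (dirichlet_monomial m n))\<^sup>2)"
    by (rule summable_finite[of "{m}"]) (auto simp: dirichlet_monomial_def)
  then show ?thesis
    using assms by (simp add: H2_0_def H2_def dirichlet_series_def dirichlet_monomial_def)
qed

lemma dirichlet_monomial_weak_fin:
  assumes "a > 1" "b > 1" shows "dirichlet_monomial (a * b) \<in> weak_fin"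
proof -
  have "[(dirichlet_monomial a, dirichlet_monomial b)] \<in> weak_reps (dirichlet_monomial (a * b))"
    using assms by (simp add: weak_reps_def dirichlet_monomial_H2_0 dirichlet_prod_monomial)
  then show ?thesis
    by (auto simp: weak_fin_def)
qed

lemma prime_square_symbol_prime: "prime p \<Longrightarrow> prime_square_symbol (p * p) = 1"
  by (auto simp: prime_square_symbol_def power2_eq_square)

text \<open>The terms of a convergent series tend to 0, yet the squares of primes supply terms equal
  to 1 beyond every index.\<close>

lemma not_H2_one_on_prime_squares:
  assumes "\<And>p. prime p \<Longrightarrow> \<phi> (p * p) = 1"
  shows "\<phi> \<notin> H2"
proof
  assume "\<phi> \<in> H2"
  then have "summable (\<lambda>n. (cmod (\<phi> n))\<^sup>2)"
    by (simp add: H2_def)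
  from order_tendstoD(2)[OF summable_LIMSEQ_zero[OF this] zero_less_one]
  obtain M where M: "\<And>n. n \<ge> M \<Longrightarrow> (cmod (\<phi> n))\<^sup>2 < 1"
    unfolding eventually_sequentially by blast
  obtain p where p: "prime p" "p > M"
    using bigger_prime by blast
  then have "p * p \<ge> M"
    by (meson le_square less_imp_le order_trans)
  then show False
    using M assms[OF p(1)] by fastforce
qed

lemma weak_dual_not_included: "\<not> dual_included weak_fin weak_norm H2 H2_norm"
proof
  assume incl: "dual_included weak_fin weak_norm H2 H2_norm"
  \<comment> \<open>Pairing with the symbol is linear on \<open>weak_fin\<close>, where its series
    converge, and bounded by \<open>weak_norm\<close>; hence it extends to the completion.\<close>
  have "\<exists>\<upsilon>\<in>completion_dual weak_fin weak_norm. \<forall>F\<in>weak_fin.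
      \<upsilon> (completion_embed weak_fin weak_norm F) = H2_inner F prime_square_symbol"
  proof (rule weak.completion_dual_extension)
    fix F G :: dseries and c :: complex
    assume F: "F \<in> weak_fin"
    show "cmod (H2_inner F prime_square_symbol) \<le> weak_norm F"
      by (rule H2_inner_prime_square_symbol_le[OF F])
    show "H2_inner (\<lambda>k. c * F k) prime_square_symbol = c * H2_inner F prime_square_symbol"
      using suminf_mult[OF summable_prime_square_symbol[OF F], of c]
      by (simp add: H2_inner_def mult.assoc)
    assume G: "G \<in> weak_fin"
    show "H2_inner (\<lambda>k. F k + G k) prime_square_symbol =
        H2_inner F prime_square_symbol + H2_inner G prime_square_symbol"
      using suminf_add[OF summable_prime_square_symbol summable_prime_square_symbol, OF F G]
      by (simp add: H2_inner_def distrib_right)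
  qed
  then obtain \<upsilon> where \<upsilon>: "\<upsilon> \<in> completion_dual weak_fin weak_norm"
    and embed: "\<And>F. F \<in> weak_fin \<Longrightarrow>
      \<upsilon> (completion_embed weak_fin weak_norm F) = H2_inner F prime_square_symbol"
    by blast
  obtain \<phi> where \<phi>: "\<phi> \<in> H2" and rep: "\<And>f. f \<in> dirichlet_poly \<inter> weak_fin \<Longrightarrow>
      \<upsilon> (completion_embed weak_fin weak_norm f) = H2_inner f \<phi>"
    using incl \<upsilon> unfolding dual_included_def by blast
  have "\<phi> (p * p) = 1" if "prime p" for p
  proof -
    \<comment> \<open>The monomial at \<open>p * p\<close> is a product of two monomials in
      \<open>H2_0\<close>, so both descriptions of the functional apply to it; comparing them reads
      off one coefficient.\<close>
    have mem: "dirichlet_monomial (p * p) \<in> dirichlet_poly \<inter> weak_fin"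
      using prime_gt_1_nat[OF that]
      by (simp add: dirichlet_monomial_poly dirichlet_monomial_weak_fin)
    then have "cnj (\<phi> (p * p)) = cnj (prime_square_symbol (p * p))"
      using rep[OF mem] embed[of "dirichlet_monomial (p * p)"] by (simp add: H2_inner_monomial)
    then show ?thesis
      using that by (simp add: prime_square_symbol_prime)
  qed
  then show False
    using not_H2_one_on_prime_squares \<phi> by blast
qed


section \<open>Orthogonality on the torus\<close>

text \<open>The integrand depends only on the coordinates in \<open>J\<close>. Restriction to
  \<open>J\<close> pushes the product measure forward to the finite product, where the integral
  factors.\<close>

lemma (in product_prob_space) integral_PiM_finite_prod:
  fixes f :: "'i \<Rightarrow> 'a \<Rightarrow> 'b::{real_normed_field, banach, second_countable_topology}"
  assumes "finite J" "J \<subseteq> I" and int: "\<And>i. i \<in> J \<Longrightarrow> integrable (M i) (f i)"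
  shows "(LINT x|PiM I M. (\<Prod>i\<in>J. f i (x i))) = (\<Prod>i\<in>J. integral\<^sup>L (M i) (f i))"
proof -
  have [measurable]: "i \<in> J \<Longrightarrow> f i \<in> borel_measurable (M i)" for i
    using int by auto
  have "(\<Prod>i\<in>J. integral\<^sup>L (M i) (f i)) = (LINT x|PiM J M. (\<Prod>i\<in>J. f i (x i)))"
    using assms by (simp add: product_integral_prod)
  also have "\<dots> = (LINT x|distr (PiM I M) (PiM J M) (\<lambda>x. restrict x J). (\<Prod>i\<in>J. f i (x i)))"
    using assms by (simp add: distr_PiM_restrict_finite)
  also have "\<dots> = (LINT x|PiM I M. (\<Prod>i\<in>J. f i (restrict x J i)))"
    using assms(2) by (intro integral_distr) (auto intro!: measurable_restrict_subset)
  finally show ?thesis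
    by (simp cong: prod.cong)
qed

lemma space_circle_measure: "space circle_measure = sphere 0 1"
  by (simp add: circle_measure_def space_restrict_space)

lemma measurable_circle_measure_id [measurable]: "(\<lambda>z. z) \<in> borel_measurable circle_measure"
  by (simp add: circle_measure_def measurable_restrict_space1)

lemma integrable_circle_measure_power: "integrable circle_measure (\<lambda>z. z ^ k)"
proof -
  interpret prob_space circle_measure
    by (rule prob_space_circle_measure)
  show ?thesis
    by (intro integrable_const_bound[of _ 1])
      (auto simp: space_circle_measure norm_power dist_norm)
qed

text \<open>Pulled back to the unit interval the integrand is \<open>exp (?c * t)\<close> with
  \<open>?c = 2 * pi * k * \<i>\<close>. Its antiderivative, obtained by dividing by the nonzero
  \<open>?c\<close>, has equal values at both endpoints.\<close>

lemma integral_circle_measure_power: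
  assumes "k > 0" shows "(LINT z|circle_measure. z ^ k) = 0"
proof -
  have [measurable]: "(\<lambda>t::real. cis (2 * pi * t)) \<in> borel_measurable borel"
    by (intro borel_measurable_continuous_onI continuous_intros)
  let ?c = "complex_of_real (2 * pi * k) * \<i>"
  have c: "?c \<noteq> 0" using assms by simp
  \<comment> \<open>The unit interval has length 1, so normalization leaves the bare indicator as
    density.\<close>
  have um: "uniform_measure lborel {0..1::real} = density lborel (indicator {0..1})"
    by (simp add: uniform_measure_def divide_ennreal_def)
  have "(LINT z|circle_measure. z ^ k) = (LINT t|uniform_measure lborel {0..1}. cis (2 * pi * t) ^ k)"
    unfolding circle_measure_def
    by (intro integral_distr measurable_restrict_space2 measurable_restrict_space1) auto
  also have "\<dots> = (LINT t|density lborel (\<lambda>t. ennreal (indicator {0..1} t)). cis (2 * pi * t) ^ k)"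
    unfolding um by (simp add: ennreal_indicator)
  also have "\<dots> = (LINT t|lborel. indicator {0..1} t *\<^sub>R cis (2 * pi * t) ^ k)"
    by (intro integral_density) auto
  also have "\<dots> = exp (?c * complex_of_real 1) / ?c - exp (?c * complex_of_real 0) / ?c"
  proof (rule integral_FTC_atLeastAtMost)
    fix t :: real
    have "cis (2 * pi * t) ^ k = exp (?c * complex_of_real t)"
      by (simp add: cis_conv_exp exp_of_nat_mult[symmetric] algebra_simps)
    moreover have "((\<lambda>t. exp (?c * complex_of_real t) / ?c) has_vector_derivative
        exp (?c * complex_of_real t)) (at t within {0..1})"
    proof -
      have "((\<lambda>z. exp (?c * z) / ?c) has_field_derivative exp (?c * complex_of_real t)) (at (complex_of_real t))"
        using c by (auto intro!: derivative_eq_intros)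
      then show ?thesis
        by (rule has_vector_derivative_real_field)
    qed
    ultimately show "((\<lambda>t. exp (?c * complex_of_real t) / ?c) has_vector_derivative
        cis (2 * pi * t) ^ k) (at t within {0..1})"
      by simp
  qed (auto intro!: continuous_intros)
  also have "exp ?c = 1"
    using exp_integer_2pi[of "of_nat k"] by (simp add: algebra_simps)
  then have "exp (?c * complex_of_real 1) / ?c - exp (?c * complex_of_real 0) / ?c = 0"
    by simp
  finally show ?thesis .
qed

text \<open>The integral factors over the distinct coordinates \<open>i\<close> and
  \<open>j\<close>, and the factor at \<open>i\<close> has mean zero.\<close>

lemma integral_torus_orthogonal:
  assumes "i \<noteq> j" "k > 0"
  shows "(LINT z|torus_measure. z i ^ k * cnj (z j ^ k)) = 0"
proof -
  interpret product_prob_space "\<lambda>_::nat. circle_measure" UNIV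
    by (simp add: product_prob_space_def product_prob_space_axioms_def product_sigma_finite_def
        prob_space_circle_measure prob_space_imp_sigma_finite)
  \<comment> \<open>One family holds both factors: the power at \<open>i\<close> and the conjugate
    power at \<open>j\<close>.\<close>
  define f where "f l z = (if l = i then z ^ k else cnj (z ^ k))" for l :: nat and z :: complex
  have "integrable circle_measure (f l)" for l
    unfolding f_def
    by (cases "l = i") (simp_all add: integrable_circle_measure_power del: complex_cnj_power)
  moreover have "integral\<^sup>L circle_measure (f i) = 0"
    using integral_circle_measure_power[OF assms(2)] by (simp add: f_def[abs_def])
  ultimately show ?thesis
    using integral_PiM_finite_prod[where f = f and J = "{i, j}"] assms
    by (simp add: torus_measure_def f_def)
qed

lemma integrable_torus_power: "integrable torus_measure (\<lambda>z. z i ^ k * cnj (z j ^ k))"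
proof -
  interpret prob_space torus_measure
    by (rule prob_space_torus_measure)
  have [measurable]: "(\<lambda>z. z l) \<in> borel_measurable torus_measure" for l
    using measurable_compose[OF measurable_component_singleton[of l UNIV "\<lambda>_. circle_measure"]
        measurable_circle_measure_id] by (simp add: torus_measure_def)
  have [measurable]: "cnj \<in> borel_measurable borel"
    by (intro borel_measurable_continuous_onI continuous_intros)
  have "(\<lambda>z. z i ^ k * cnj (z j ^ k)) \<in> borel_measurable torus_measure"
    by measurable
  then show ?thesis
    by (intro integrable_const_bound[of _ 1])
      (auto simp: space_torus_measure norm_mult norm_power)
qed

lemma integral_torus_orthonormal:
  assumes "k > 0"
  shows "(LINT z|torus_measure. z i ^ k * cnj (z j ^ k)) = of_bool (i = j)"
proof (cases "i = j")
  case True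
  interpret prob_space torus_measure
    by (rule prob_space_torus_measure)
  \<comment> \<open>Coordinates on the torus have modulus 1, so the integral is the total
    mass.\<close>
  have "(LINT z|torus_measure. z i ^ k * cnj (z i ^ k)) = (LINT z|torus_measure. 1)"
    by (intro Bochner_Integration.integral_cong)
      (simp_all add: space_torus_measure norm_power complex_norm_square[symmetric]
        del: complex_cnj_power)
  then show ?thesis
    using True by (simp add: prob_space)
qed (use assms integral_torus_orthogonal in simp)

text \<open>Bessel's inequality by hand: if \<open>S\<close> is the sum of the first
  \<open>n\<close> functions \<open>z j ^ k\<close>, then \<open>S - \<psi>\<close> has squared norm
  \<open>n - n - n + A\<close>, where \<open>A\<close> is the squared norm of \<open>\<psi>\<close>.
  This is nonnegative, so \<open>n \<le> A\<close> for every \<open>n\<close>.\<close>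

lemma no_L2_torus_coefficients_one:
  assumes \<psi>: "\<psi> \<in> L2_torus" and k: "k > 0"
    and coeff: "\<And>j. (LINT z|torus_measure. z j ^ k * cnj (\<psi> z)) = 1"
  shows False
proof -
  let ?T = torus_measure
  define A where "A = (LINT z|?T. (cmod (\<psi> z))\<^sup>2)"
  have int\<psi>: "integrable ?T (\<lambda>z. (cmod (\<psi> z))\<^sup>2)"
    using \<psi> by (simp add: L2_torus_def)
  \<comment> \<open>A function that is not integrable has integral 0 by convention, so the value 1
    forces integrability.\<close>
  have intc: "integrable ?T (\<lambda>z. z j ^ k * cnj (\<psi> z))" for j
    using coeff[of j] not_integrable_integral_eq by fastforce
  have "real n \<le> A" for n
  proof -
    define SS where "SS z = (\<Sum>i<n. \<Sum>j<n. z i ^ k * cnj (z j ^ k))" for z :: "nat \<Rightarrow> complex"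
    define SP where "SP z = (\<Sum>j<n. z j ^ k * cnj (\<psi> z))" for z
    \<comment> \<open>This expands the squared modulus of \<open>S - \<psi>\<close>:
      \<open>SS\<close> is \<open>S\<close> times its conjugate and \<open>SP\<close> is
      \<open>S\<close> times the conjugate of \<open>\<psi>\<close>.\<close>
    have eq: "complex_of_real ((cmod ((\<Sum>j<n. z j ^ k) - \<psi> z))\<^sup>2) =
        SS z - SP z - cnj (SP z) + complex_of_real ((cmod (\<psi> z))\<^sup>2)" for z
    proof -
      have "SS z = (\<Sum>j<n. z j ^ k) * cnj (\<Sum>j<n. z j ^ k)"
        by (simp add: SS_def sum_product)
      moreover have "SP z = (\<Sum>j<n. z j ^ k) * cnj (\<psi> z)"
        by (simp add: SP_def sum_distrib_right)
      ultimately show ?thesis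
        by (simp only: complex_norm_square) (simp add: algebra_simps)
    qed
    have intSS: "integrable ?T SS" and intSP: "integrable ?T SP"
      unfolding SS_def SP_def by (intro Bochner_Integration.integrable_sum integrable_torus_power intc)+
    have SS: "integral\<^sup>L ?T SS = of_nat n"
      by (simp add: SS_def[abs_def] Bochner_Integration.integral_sum integrable_torus_power
          integral_torus_orthonormal[OF k] del: complex_cnj_power)
    have SP: "integral\<^sup>L ?T SP = of_nat n"
      by (simp add: SP_def[abs_def] Bochner_Integration.integral_sum intc coeff)
    have "complex_of_real (LINT z|?T. (cmod ((\<Sum>j<n. z j ^ k) - \<psi> z))\<^sup>2) =
        (LINT z|?T. SS z - SP z - cnj (SP z) + complex_of_real ((cmod (\<psi> z))\<^sup>2))"
      by (simp only: integral_complex_of_real[symmetric] eq)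
    also have "\<dots> = integral\<^sup>L ?T SS - integral\<^sup>L ?T SP - cnj (integral\<^sup>L ?T SP) + complex_of_real A"
      using intSS intSP int\<psi> by (simp add: A_def del: of_real_power)
    also have "\<dots> = complex_of_real (A - real n)"
      by (simp add: SS SP)
    finally have "(LINT z|?T. (cmod ((\<Sum>j<n. z j ^ k) - \<psi> z))\<^sup>2) = A - real n"
      using of_real_eq_iff by blast
    moreover have "(LINT z|?T. (cmod ((\<Sum>j<n. z j ^ k) - \<psi> z))\<^sup>2) \<ge> 0"
      by (rule Bochner_Integration.integral_nonneg) simp
    ultimately show ?thesis by simp
  qed
  then show False
    using reals_Archimedean2[of A] by (meson not_less)
qed

section \<open>The Bohr lift at primes and the conclusion\<close>

lemma prime_nth_prime: "prime (nth_prime j)"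
  using enumerate_in_set[OF primes_infinite] by (simp add: nth_prime_def)

lemma nth_prime_eq_iff: "nth_prime i = nth_prime j \<longleftrightarrow> i = j"
  unfolding nth_prime_def
  by (rule strict_mono_eq[OF strict_mono_enumerate[OF primes_infinite]])

text \<open>A prime dividing a prime equals it, and the enumeration of primes is injective, so
  \<open>j\<close> is the only index in the product, with exponent 1.\<close>

lemma bohr_lift_nth_prime: "bohr_lift (dirichlet_monomial (nth_prime j)) z = z j"
proof -
  have "{i. nth_prime i dvd nth_prime j} = {j}"
    using primes_dvd_imp_eq[OF prime_nth_prime prime_nth_prime] by (auto simp: nth_prime_eq_iff)
  moreover have "multiplicity (nth_prime j) (nth_prime j) = 1"
    using prime_nth_prime[of j] by (intro multiplicity_self) (auto simp: prime_gt_0_nat)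
  ultimately have "bohr_monomial (nth_prime j) z = z j"
    by (simp add: bohr_monomial_def)
  then show ?thesis
    by (simp add: bohr_lift_def dirichlet_monomial_def)
qed

theorem corollary2:
  "\<not> dual_included weak_fin weak_norm H2 H2_norm \<and>
   (\<exists>\<phi>\<in>dirichlet_series. hankel_bounded \<phi> \<and>
      \<not> (\<exists>\<psi>\<in>L2_torus. \<forall>f\<in>dirichlet_poly \<inter> H2_0. \<forall>g\<in>dirichlet_poly \<inter> H2_0.
            hankel \<phi> f g = hankel_torus \<psi> f g))"
proof (intro conjI weak_dual_not_included bexI[of _ prime_square_symbol])
  show "prime_square_symbol \<in> dirichlet_series"
    by (auto simp: dirichlet_series_def prime_square_symbol_def)
  show "hankel_bounded prime_square_symbol"
    unfolding hankel_bounded_def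
    \<comment> \<open>The constant 1 is that of the Cauchy-Schwarz bound for the symbol.\<close>
    by (intro exI[of _ 1]) (simp add: hankel_prime_square_symbol(2))
  show "\<not> (\<exists>\<psi>\<in>L2_torus. \<forall>f\<in>dirichlet_poly \<inter> H2_0. \<forall>g\<in>dirichlet_poly \<inter> H2_0.
            hankel prime_square_symbol f g = hankel_torus \<psi> f g)"
  proof
    assume "\<exists>\<psi>\<in>L2_torus. \<forall>f\<in>dirichlet_poly \<inter> H2_0. \<forall>g\<in>dirichlet_poly \<inter> H2_0.
            hankel prime_square_symbol f g = hankel_torus \<psi> f g"
    then obtain \<psi> where \<psi>: "\<psi> \<in> L2_torus"
      and eq: "\<And>f. f \<in> dirichlet_poly \<inter> H2_0 \<Longrightarrow> hankel prime_square_symbol f f = hankel_torus \<psi> f f"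
      by blast
    \<comment> \<open>Both arguments are taken to be the monomial of the prime with index
      \<open>j\<close>. The Hankel form then reads the symbol at the square of that prime, and the
      torus form integrates \<open>z j ^ 2\<close> against the conjugate of
      \<open>\<psi>\<close>.\<close>
    have "(LINT z|torus_measure. z j ^ 2 * cnj (\<psi> z)) = 1" for j
    proof -
      let ?p = "nth_prime j"
      have p: "prime ?p" "?p > 1" "?p > 0"
        using prime_nth_prime[of j] prime_gt_Suc_0_nat prime_gt_0_nat by auto
      have "hankel_torus \<psi> (dirichlet_monomial ?p) (dirichlet_monomial ?p) = cnj (prime_square_symbol (?p * ?p))"
        using p by (simp add: eq[symmetric] dirichlet_monomial_poly dirichlet_monomial_H2_0
            hankel_def dirichlet_prod_monomial H2_inner_monomial)
      then show ?thesis
        using p by (simp add: prime_square_symbol_prime hankel_torus_def bohr_lift_nth_prime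
            power2_eq_square)
    qed
    then show False
      using no_L2_torus_coefficients_one[OF \<psi>, of 2] by simp
  qed
qed

end
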